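(* The sum lattice $L$ of a modular connected system has a minimum element if and only if the skeleton lattice $S$ has a minimum element.
   Context: A lattice is l.f.f.c. if every closed interval is finite and every element has finitely many upper covers and finitely many lower covers. $x\lessdot y$ means $y$ covers $x$. A tolerance on a lattice $S$ is a reflexive, symmetric relation $\gamma$ with $a\,\gamma\,b$, $c\,\gamma\,d$ implying $(a\vee c)\,\gamma\,(b\vee d)$ and $(a\wedge c)\,\gamma\,(b\wedge d)$; $x\le_\gamma y$ means $x\le y$ and $x\,\gamma\,y$. A modular connected system $(S,\gamma,(L_x)_{x\in S},(\varphi_x^y)_{x\le_\gamma y})$ (with skeleton $S$) is a lattice $S$, a tolerance $\gamma$ on $S$, lattices $L_x$ and maps $\varphi_x^y$ satisfying: (MC1) $S$ is l.f.f.c.; (MC2) each $L_x$ is finite, modular, complemented; (MC3) each $\varphi_x^y$ is a lattice isomorphism from a nonempty lattice filter $F_x^y$ of $L_x$ onto a lattice ideal $I_x^y$ of $L_y$; (MC4) $F_x^x=I_x^x=L_x$, $\varphi_x^x=\mathrm{id}$; (MC5) if $x\le_\gamma y\le_\gamma z$ and $I_x^y\cap F_y^z\neq\emptyset$ then $x\,\gamma\,z$; (MC6) for $x\le z\le y$ with $x\,\gamma\,y$: $F_x^y=(\varphi_x^z)^{-1}(I_x^z\cap F_z^y)$, $I_x^y=\varphi_z^y(I_x^z\cap F_z^y)$, $\varphi_x^y=\varphi_z^y\circ\varphi_x^z|_{F_x^y}$; (MC7) if $x\,\gamma\,y$ then $I_x^{x\vee y}\cap I_y^{x\vee y}\subseteq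 I_{x\wedge y}^{x\vee y}$ and $F_{x\wedge y}^x\cap F_{x\wedge y}^y\subseteq F_{x\wedge y}^{x\vee y}$; (MC8.1) $x\lessdot y$ implies $x\,\gamma\,y$; (MC8.2) $x\lessdot y$ implies $F_x^y\neq L_x$ and $I_x^y\neq L_y$. Sum: $M=\{(x,a):x\in S,a\in L_x\}$, $(x,a)\sim(y,b)$ iff $x\,\gamma\,y$, $a\in F_x^{x\vee y}$, $b\in F_y^{x\vee y}$, $\varphi_x^{x\vee y}(a)=\varphi_y^{x\vee y}(b)$ (an equivalence relation); $L=M/{\sim}$; $\pi_x(a)$ is the class of $(x,a)$, $\Lambda_x=\pi_x(L_x)$. For $v\in S$, $a\le_v b$ iff $a,b\in\Lambda_v$ and $\pi_v^{-1}a\le\pi_v^{-1}b$ in $L_v$. $L$ is ordered by $a\le b$ iff there exist $n\ge0$, $x_1\le\dots\le x_n$ in $S$ and $a=a_0\le_{x_1}a_1\le_{x_2}\cdots\le_{x_n}a_n=b$; with this order $L$ is a lattice. *)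

theory Defs
  imports "HOL-Algebra.Lattice"
begin

text \<open>
  The skeleton is a type of class \<open>lattice\<close>.  The blocks are carrier-based lattices of HOL-Algebra
  over one common element type \<open>'b\<close>.  They need not be disjoint, since the sum is formed from pairs.
\<close>

definition covered_by :: "'s::order \<Rightarrow> 's \<Rightarrow> bool" (infix \<open>\<lessdot>\<close> 50)
  where "x \<lessdot> y \<longleftrightarrow> x < y \<and> \<not> (\<exists>z. x < z \<and> z < y)"

definition lffc :: "'s::lattice itself \<Rightarrow> bool"
  where "lffc _ \<longleftrightarrow>
    (\<forall>a b :: 's. finite {a..b}) \<and>
    (\<forall>a :: 's. finite {b. a \<lessdot> b} \<and> finite {b. b \<lessdot> a})"

definition tolerance :: "('s::lattice \<Rightarrow> 's \<Rightarrow> bool) \<Rightarrow> bool"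
  where "tolerance \<gamma> \<longleftrightarrow> reflp \<gamma> \<and> symp \<gamma> \<and>
    (\<forall>a b c d. \<gamma> a b \<longrightarrow> \<gamma> c d \<longrightarrow> \<gamma> (sup a c) (sup b d) \<and> \<gamma> (inf a c) (inf b d))"

definition tol_le :: "('s::lattice \<Rightarrow> 's \<Rightarrow> bool) \<Rightarrow> 's \<Rightarrow> 's \<Rightarrow> bool"
  where "tol_le \<gamma> x y \<longleftrightarrow> x \<le> y \<and> \<gamma> x y"

definition modular_lattice :: "'b gorder \<Rightarrow> bool"
  where "modular_lattice K \<longleftrightarrow> lattice K \<and>
    (\<forall>a\<in>carrier K. \<forall>b\<in>carrier K. \<forall>c\<in>carrier K.
      a \<sqsubseteq>\<^bsub>K\<^esub> c \<longrightarrow> a \<squnion>\<^bsub>K\<^esub> (b \<sqinter>\<^bsub>K\<^esub> c) = (a \<squnion>\<^bsub>K\<^esub> b) \<sqinter>\<^bsub>K\<^esub> c)"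

definition complemented_lattice :: "'b gorder \<Rightarrow> bool"
  where "complemented_lattice K \<longleftrightarrow> bounded_lattice K \<and>
    (\<forall>a\<in>carrier K. \<exists>b\<in>carrier K. a \<squnion>\<^bsub>K\<^esub> b = \<top>\<^bsub>K\<^esub> \<and> a \<sqinter>\<^bsub>K\<^esub> b = \<bottom>\<^bsub>K\<^esub>)"

definition lattice_filter :: "'b gorder \<Rightarrow> 'b set \<Rightarrow> bool"
  where "lattice_filter K A \<longleftrightarrow> A \<subseteq> carrier K \<and>
    (\<forall>a\<in>A. \<forall>b\<in>carrier K. a \<sqsubseteq>\<^bsub>K\<^esub> b \<longrightarrow> b \<in> A) \<and>
    (\<forall>a\<in>A. \<forall>b\<in>A. a \<sqinter>\<^bsub>K\<^esub> b \<in> A)"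

definition lattice_ideal :: "'b gorder \<Rightarrow> 'b set \<Rightarrow> bool"
  where "lattice_ideal K A \<longleftrightarrow> A \<subseteq> carrier K \<and>
    (\<forall>a\<in>A. \<forall>b\<in>carrier K. b \<sqsubseteq>\<^bsub>K\<^esub> a \<longrightarrow> b \<in> A) \<and>
    (\<forall>a\<in>A. \<forall>b\<in>A. a \<squnion>\<^bsub>K\<^esub> b \<in> A)"

definition lattice_iso :: "'b gorder \<Rightarrow> 'b gorder \<Rightarrow> ('b \<Rightarrow> 'b) \<Rightarrow> bool"
  where "lattice_iso K K' f \<longleftrightarrow>
    join_pres K K' f \<and> meet_pres K K' f \<and> bij_betw f (carrier K) (carrier K')"

text \<open>
  The partial map \<open>\<phi>\<^sub>x\<^sup>y\<close> is given by its domain \<open>F x y\<close> and a total function \<open>\<phi> x y\<close> whose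
  values outside \<open>F x y\<close> are irrelevant; \<open>I\<^sub>x\<^sup>y\<close> is the image.  These data are meaningful only for
  \<open>tol_le \<gamma> x y\<close>.
\<close>

abbreviation mc_image :: "('s \<Rightarrow> 's \<Rightarrow> 'b set) \<Rightarrow> ('s \<Rightarrow> 's \<Rightarrow> 'b \<Rightarrow> 'b) \<Rightarrow> 's \<Rightarrow> 's \<Rightarrow> 'b set"
  where "mc_image F \<phi> x y \<equiv> \<phi> x y ` F x y"

locale modular_connected_system =
  fixes \<gamma> :: "'s::lattice \<Rightarrow> 's \<Rightarrow> bool"
    and L :: "'s \<Rightarrow> 'b gorder"
    and F :: "'s \<Rightarrow> 's \<Rightarrow> 'b set"
    and \<phi> :: "'s \<Rightarrow> 's \<Rightarrow> 'b \<Rightarrow> 'b"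
    and I :: "'s \<Rightarrow> 's \<Rightarrow> 'b set"
  defines "I \<equiv> mc_image F \<phi>"
  assumes tolerance: "tolerance \<gamma>"
    and lffc: "lffc TYPE('s)"
    and block: "finite (carrier (L x))" "modular_lattice (L x)" "complemented_lattice (L x)"
    and filter: "tol_le \<gamma> x y \<Longrightarrow> lattice_filter (L x) (F x y) \<and> F x y \<noteq> {}"
    and ideal: "tol_le \<gamma> x y \<Longrightarrow> lattice_ideal (L y) (I x y)"
    and iso: "tol_le \<gamma> x y \<Longrightarrow>
      lattice_iso (L x\<lparr>carrier := F x y\<rparr>) (L y\<lparr>carrier := I x y\<rparr>) (\<phi> x y)"
    and id: "F x x = carrier (L x)" "I x x = carrier (L x)" "a \<in> carrier (L x) \<Longrightarrow> \<phi> x x a = a"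
    and chain_tol: "\<lbrakk>tol_le \<gamma> x y; tol_le \<gamma> y z; I x y \<inter> F y z \<noteq> {}\<rbrakk> \<Longrightarrow> \<gamma> x z"
    and comp_dom: "\<lbrakk>x \<le> z; z \<le> y; \<gamma> x y\<rbrakk> \<Longrightarrow>
      F x y = {a \<in> F x z. \<phi> x z a \<in> I x z \<inter> F z y}"
    and comp_img: "\<lbrakk>x \<le> z; z \<le> y; \<gamma> x y\<rbrakk> \<Longrightarrow> I x y = \<phi> z y ` (I x z \<inter> F z y)"
    and comp: "\<lbrakk>x \<le> z; z \<le> y; \<gamma> x y; a \<in> F x y\<rbrakk> \<Longrightarrow> \<phi> x y a = \<phi> z y (\<phi> x z a)"
    and square_img: "\<gamma> x y \<Longrightarrow> I x (sup x y) \<inter> I y (sup x y) \<subseteq> I (inf x y) (sup x y)"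
    and square_dom: "\<gamma> x y \<Longrightarrow> F (inf x y) x \<inter> F (inf x y) y \<subseteq> F (inf x y) (sup x y)"
    and cover_tol: "x \<lessdot> y \<Longrightarrow> \<gamma> x y"
    and cover_proper: "x \<lessdot> y \<Longrightarrow> F x y \<noteq> carrier (L x)" "x \<lessdot> y \<Longrightarrow> I x y \<noteq> carrier (L y)"

definition sum_rel :: "('s::lattice \<Rightarrow> 's \<Rightarrow> bool) \<Rightarrow> ('s \<Rightarrow> 'b gorder) \<Rightarrow> ('s \<Rightarrow> 's \<Rightarrow> 'b set)
    \<Rightarrow> ('s \<Rightarrow> 's \<Rightarrow> 'b \<Rightarrow> 'b) \<Rightarrow> ('s \<times> 'b) rel"
  where "sum_rel \<gamma> L F \<phi> = {((x, a), (y, b)) | x a y b.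
    a \<in> carrier (L x) \<and> b \<in> carrier (L y) \<and> \<gamma> x y \<and>
    a \<in> F x (sup x y) \<and> b \<in> F y (sup x y) \<and> \<phi> x (sup x y) a = \<phi> y (sup x y) b}"

definition sum_proj :: "('s::lattice \<Rightarrow> 's \<Rightarrow> bool) \<Rightarrow> ('s \<Rightarrow> 'b gorder) \<Rightarrow> ('s \<Rightarrow> 's \<Rightarrow> 'b set)
    \<Rightarrow> ('s \<Rightarrow> 's \<Rightarrow> 'b \<Rightarrow> 'b) \<Rightarrow> 's \<Rightarrow> 'b \<Rightarrow> ('s \<times> 'b) set"
  where "sum_proj \<gamma> L F \<phi> x a = sum_rel \<gamma> L F \<phi> `` {(x, a)}"

definition sum_block :: "('s::lattice \<Rightarrow> 's \<Rightarrow> bool) \<Rightarrow> ('s \<Rightarrow> 'b gorder) \<Rightarrow> ('s \<Rightarrow> 's \<Rightarrow> 'b set)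
    \<Rightarrow> ('s \<Rightarrow> 's \<Rightarrow> 'b \<Rightarrow> 'b) \<Rightarrow> 's \<Rightarrow> ('s \<times> 'b) set set"
  where "sum_block \<gamma> L F \<phi> x = sum_proj \<gamma> L F \<phi> x ` carrier (L x)"

definition sum_local_le :: "('s::lattice \<Rightarrow> 's \<Rightarrow> bool) \<Rightarrow> ('s \<Rightarrow> 'b gorder)
    \<Rightarrow> ('s \<Rightarrow> 's \<Rightarrow> 'b set) \<Rightarrow> ('s \<Rightarrow> 's \<Rightarrow> 'b \<Rightarrow> 'b)
    \<Rightarrow> 's \<Rightarrow> ('s \<times> 'b) set \<Rightarrow> ('s \<times> 'b) set \<Rightarrow> bool"
  where "sum_local_le \<gamma> L F \<phi> v A B \<longleftrightarrow>
    A \<in> sum_block \<gamma> L F \<phi> v \<and> B \<in> sum_block \<gamma> L F \<phi> v \<and>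
    the_inv_into (carrier (L v)) (sum_proj \<gamma> L F \<phi> v) A
      \<sqsubseteq>\<^bsub>L v\<^esub> the_inv_into (carrier (L v)) (sum_proj \<gamma> L F \<phi> v) B"

text \<open>The \<open>i\<close>-th step of a chain goes from \<open>c i\<close> to \<open>c (Suc i)\<close> inside block \<open>x i\<close>, with \<open>i < n\<close>.\<close>

definition sum_le :: "('s::lattice \<Rightarrow> 's \<Rightarrow> bool) \<Rightarrow> ('s \<Rightarrow> 'b gorder) \<Rightarrow> ('s \<Rightarrow> 's \<Rightarrow> 'b set)
    \<Rightarrow> ('s \<Rightarrow> 's \<Rightarrow> 'b \<Rightarrow> 'b) \<Rightarrow> ('s \<times> 'b) set \<Rightarrow> ('s \<times> 'b) set \<Rightarrow> bool"
  where "sum_le \<gamma> L F \<phi> A B \<longleftrightarrow>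
    (\<exists>(n::nat) (x :: nat \<Rightarrow> 's) (c :: nat \<Rightarrow> ('s \<times> 'b) set).
      (\<forall>i. Suc i < n \<longrightarrow> x i \<le> x (Suc i)) \<and>
      c 0 = A \<and> c n = B \<and> (\<forall>i<n. sum_local_le \<gamma> L F \<phi> (x i) (c i) (c (Suc i))))"

definition sum_lattice :: "('s::lattice \<Rightarrow> 's \<Rightarrow> bool) \<Rightarrow> ('s \<Rightarrow> 'b gorder) \<Rightarrow> ('s \<Rightarrow> 's \<Rightarrow> 'b set)
    \<Rightarrow> ('s \<Rightarrow> 's \<Rightarrow> 'b \<Rightarrow> 'b) \<Rightarrow> ('s \<times> 'b) set gorder"
  where "sum_lattice \<gamma> L F \<phi> =
    \<lparr>carrier = (SIGMA x:UNIV. carrier (L x)) // sum_rel \<gamma> L F \<phi>,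
     eq = (=), le = sum_le \<gamma> L F \<phi>\<rparr>"

end

theory Submission
  imports Defs
begin

text \<open>
  The key point is that the order of the sum, restricted to a block \<open>\<Lambda>\<^sub>w\<close>, is just the order of
  that block. Given an ascending chain of local steps with both ends in \<open>\<Lambda>\<^sub>w\<close>, one first lifts all
  steps to the indices \<open>w \<squnion> x\<^sub>i\<close>; the last point of the chain then lies in all lifted blocks, so
  that the steps can be composed while descending from the last block to \<open>\<Lambda>\<^sub>w\<close>.

  If \<open>m\<close> is the minimum of the sum and \<open>m \<in> \<Lambda>\<^sub>x\<close>, then \<open>m = \<pi>\<^sub>x \<bottom>\<close>. For a lower cover \<open>w\<close> of \<open>x\<close>
  the ideal \<open>I\<^sub>w\<^sup>x\<close> contains \<open>\<bottom>\<close>, so \<open>m \<in> \<Lambda>\<^sub>w\<close>, hence \<open>m = \<pi>\<^sub>w \<bottom>\<close> and the filter \<open>F\<^sub>w\<^sup>x\<close> contains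
  \<open>\<bottom>\<close>, contrary to (MC8.2). So \<open>x\<close> is minimal, hence the minimum of \<open>S\<close>. Conversely, if \<open>S\<close> has a
  minimum \<open>0\<close>, the same ideals give \<open>\<pi>\<^sub>w \<bottom> \<le> \<pi>\<^sub>x \<bottom>\<close> for every cover \<open>w \<lessdot> x\<close>, so \<open>\<pi>\<^sub>0 \<bottom>\<close> is the
  minimum of the sum.
\<close>

section \<open>Order isomorphisms and lower covers\<close>

text \<open>On both sides \<open>a\<close> is below \<open>b\<close> exactly when joining
  \<open>a\<close> to \<open>b\<close> gives \<open>b\<close>; \<open>f\<close> preserves joins and
  is injective on the carrier.\<close>

lemma lattice_iso_le_iff:
  assumes "lattice_iso K K' f" "a \<in> carrier K" "b \<in> carrier K"
  shows "f a \<sqsubseteq>\<^bsub>K'\<^esub> f b \<longleftrightarrow> a \<sqsubseteq>\<^bsub>K\<^esub> b"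
proof -
  have jp: "join_pres K K' f" and bij: "bij_betw f (carrier K) (carrier K')"
    using assms(1) by (auto simp: lattice_iso_def)
  interpret K: lattice K using jp by (simp add: join_pres_def)
  interpret K': lattice K' using jp by (simp add: join_pres_def)
  have mem: "f a \<in> carrier K'" "f b \<in> carrier K'" "a \<squnion>\<^bsub>K\<^esub> b \<in> carrier K"
    using assms(2,3) bij_betwE[OF bij] by auto
  have "f (a \<squnion>\<^bsub>K\<^esub> b) = f a \<squnion>\<^bsub>K'\<^esub> f b"
    using jp assms(2,3) by (simp add: join_pres_def)
  moreover have "f b = f (a \<squnion>\<^bsub>K\<^esub> b) \<longleftrightarrow> b = a \<squnion>\<^bsub>K\<^esub> b"
    using bij assms(3) mem(3) by (metis bij_betw_imp_inj_on inj_on_eq_iff)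
  ultimately show ?thesis
    using K.le_iff_meet[OF assms(2,3)] K'.le_iff_meet[OF mem(1,2)] by (simp add: eq_commute)
qed

text \<open>Intervals are finite, so \<open>{w..<x}\<close> has a maximal element, and nothing fits
  between it and \<open>x\<close>.\<close>

lemma lffc_lower_cover:
  fixes x w :: "'s::lattice"
  assumes "lffc TYPE('s)" "w < x"
  obtains v where "w \<le> v" "v \<lessdot> x"
proof -
  have "finite {w..x}"
    using assms(1) by (simp add: lffc_def)
  then have "finite {w..<x}"
    by (rule rev_finite_subset) auto
  moreover have "w \<in> {w..<x}"
    using assms(2) by simp
  ultimately obtain v where v: "v \<in> {w..<x}" "w \<le> v" "\<forall>b\<in>{w..<x}. v \<le> b \<longrightarrow> v = b"
    by (meson finite_has_maximal2)
  have "v \<lessdot> x"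
    unfolding covered_by_def
  proof (intro conjI notI)
    show "v < x"
      using v(1) by simp
    assume "\<exists>z. v < z \<and> z < x"
    then obtain z where z: "v < z" "z < x" by blast
    then have "z \<in> {w..<x}"
      using v(2) by auto
    with v(3) have "v \<le> z \<longrightarrow> v = z" ..
    then show False
      using z(1) by auto
  qed
  with v(2) that show thesis by blast
qed

section \<open>Tolerance, blocks and connecting maps\<close>

context modular_connected_system
begin

abbreviation "proj \<equiv> sum_proj \<gamma> L F \<phi>"
abbreviation "\<Lambda> \<equiv> sum_block \<gamma> L F \<phi>"
abbreviation "local_le \<equiv> sum_local_le \<gamma> L F \<phi>"

lemma tol_refl: "\<gamma> x x"
  and tol_sym: "\<gamma> x y \<Longrightarrow> \<gamma> y x"
  and tol_sup: "\<gamma> x y \<Longrightarrow> \<gamma> x' y' \<Longrightarrow> \<gamma> (sup x x') (sup y y')"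
  and tol_inf: "\<gamma> x y \<Longrightarrow> \<gamma> x' y' \<Longrightarrow> \<gamma> (inf x x') (inf y y')"
  using tolerance unfolding tolerance_def by (auto dest: reflpD sympD)

text \<open>Meet the related pair with \<open>z\<close>; \<open>tol_upper\<close> is the
  dual.\<close>

lemma tol_lower: "x \<le> z \<Longrightarrow> z \<le> y \<Longrightarrow> \<gamma> x y \<Longrightarrow> \<gamma> x z"
  using tol_inf[OF _ tol_refl, of x y z] by (simp add: inf_absorb1 inf_absorb2)

lemma tol_upper: "x \<le> z \<Longrightarrow> z \<le> y \<Longrightarrow> \<gamma> x y \<Longrightarrow> \<gamma> z y"
  using tol_sup[OF _ tol_refl, of x y z] by (simp add: sup_absorb1 sup_absorb2)

lemma tol_le_sup:
  assumes "\<gamma> x y"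
  shows "\<gamma> x (sup x y)" "\<gamma> y (sup x y)"
  using tol_sup[OF tol_refl assms, of x] tol_sup[OF tol_sym[OF assms] tol_refl, of y]
  by simp_all

lemma block_lattice: "lattice (L x)"
  using block(2)[of x] by (simp add: modular_lattice_def)

lemma block_refl: "a \<in> carrier (L x) \<Longrightarrow> a \<sqsubseteq>\<^bsub>L x\<^esub> a"
proof -
  interpret lattice "L x" by (rule block_lattice)
  show "a \<in> carrier (L x) \<Longrightarrow> a \<sqsubseteq>\<^bsub>L x\<^esub> a" by simp
qed

lemma block_trans:
  "\<lbrakk>a \<sqsubseteq>\<^bsub>L x\<^esub> b; b \<sqsubseteq>\<^bsub>L x\<^esub> c; a \<in> carrier (L x); b \<in> carrier (L x); c \<in> carrier (L x)\<rbrakk>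
    \<Longrightarrow> a \<sqsubseteq>\<^bsub>L x\<^esub> c"
proof -
  interpret lattice "L x" by (rule block_lattice)
  show "\<lbrakk>a \<sqsubseteq>\<^bsub>L x\<^esub> b; b \<sqsubseteq>\<^bsub>L x\<^esub> c; a \<in> carrier (L x); b \<in> carrier (L x); c \<in> carrier (L x)\<rbrakk>
    \<Longrightarrow> a \<sqsubseteq>\<^bsub>L x\<^esub> c"
    by (rule le_trans)
qed

lemma block_antisym:
  "\<lbrakk>a \<sqsubseteq>\<^bsub>L x\<^esub> b; b \<sqsubseteq>\<^bsub>L x\<^esub> a; a \<in> carrier (L x); b \<in> carrier (L x)\<rbrakk> \<Longrightarrow> a = b"
proof -
  interpret lattice "L x" by (rule block_lattice)
  show "\<lbrakk>a \<sqsubseteq>\<^bsub>L x\<^esub> b; b \<sqsubseteq>\<^bsub>L x\<^esub> a; a \<in> carrier (L x); b \<in> carrier (L x)\<rbrakk> \<Longrightarrow> a = b"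
    by (rule le_antisym)
qed

lemma
  shows block_bottom_closed: "\<bottom>\<^bsub>L x\<^esub> \<in> carrier (L x)"
    and block_bottom_lower: "a \<in> carrier (L x) \<Longrightarrow> \<bottom>\<^bsub>L x\<^esub> \<sqsubseteq>\<^bsub>L x\<^esub> a"
proof -
  interpret bounded_lattice "L x"
    using block(3)[of x] by (simp add: complemented_lattice_def)
  show "\<bottom>\<^bsub>L x\<^esub> \<in> carrier (L x)" by simp
  show "a \<in> carrier (L x) \<Longrightarrow> \<bottom>\<^bsub>L x\<^esub> \<sqsubseteq>\<^bsub>L x\<^esub> a" by simp
qed

lemma F_closed: "tol_le \<gamma> x y \<Longrightarrow> a \<in> F x y \<Longrightarrow> a \<in> carrier (L x)"
  using filter unfolding lattice_filter_def by blast

lemma F_upward: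
  "\<lbrakk>tol_le \<gamma> x y; a \<in> F x y; b \<in> carrier (L x); a \<sqsubseteq>\<^bsub>L x\<^esub> b\<rbrakk> \<Longrightarrow> b \<in> F x y"
  using filter unfolding lattice_filter_def by blast

lemma I_closed: "tol_le \<gamma> x y \<Longrightarrow> a \<in> I x y \<Longrightarrow> a \<in> carrier (L y)"
  using ideal unfolding lattice_ideal_def by blast

lemma I_downward:
  "\<lbrakk>tol_le \<gamma> x y; a \<in> I x y; b \<in> carrier (L y); b \<sqsubseteq>\<^bsub>L y\<^esub> a\<rbrakk> \<Longrightarrow> b \<in> I x y"
  using ideal unfolding lattice_ideal_def by blast

lemma \<phi>_in_I: "a \<in> F x y \<Longrightarrow> \<phi> x y a \<in> I x y"
  by (simp add: I_def)

lemma \<phi>_closed: "tol_le \<gamma> x y \<Longrightarrow> a \<in> F x y \<Longrightarrow> \<phi> x y a \<in> carrier (L y)"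
  by (metis I_closed \<phi>_in_I)

lemma \<phi>_inj: "\<lbrakk>tol_le \<gamma> x y; a \<in> F x y; b \<in> F x y; \<phi> x y a = \<phi> x y b\<rbrakk> \<Longrightarrow> a = b"
  using iso unfolding lattice_iso_def bij_betw_def inj_on_def by fastforce

lemma \<phi>_le_iff:
  "\<lbrakk>tol_le \<gamma> x y; a \<in> F x y; b \<in> F x y\<rbrakk> \<Longrightarrow> \<phi> x y a \<sqsubseteq>\<^bsub>L y\<^esub> \<phi> x y b \<longleftrightarrow> a \<sqsubseteq>\<^bsub>L x\<^esub> b"
  using lattice_iso_le_iff[OF iso[of x y], of a b] by simp

lemma F_restrict:
  assumes "x \<le> z" "z \<le> y" "\<gamma> x y" "a \<in> F x y"
  shows "a \<in> F x z" "\<phi> x z a \<in> F z y" "\<phi> x y a = \<phi> z y (\<phi> x z a)"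
  using comp_dom[OF assms(1-3)] comp[OF assms] assms(4) by auto

text \<open>Converse of \<open>F_restrict\<close>. The image of \<open>a\<close> witnesses that
  \<open>I x z\<close> and \<open>F z y\<close> meet, so \<open>chain_tol\<close> relates
  \<open>x\<close> and \<open>y\<close>, and then \<open>comp_dom\<close> and \<open>comp\<close>
  apply.\<close>

lemma F_extend:
  assumes "tol_le \<gamma> x z" "tol_le \<gamma> z y" "a \<in> F x z" "\<phi> x z a \<in> F z y"
  shows "\<gamma> x y" "a \<in> F x y" "\<phi> x y a = \<phi> z y (\<phi> x z a)"
proof -
  show tol: "\<gamma> x y"
    using chain_tol[OF assms(1,2)] \<phi>_in_I[OF assms(3)] assms(4) by blast
  have le: "x \<le> z" "z \<le> y"
    using assms(1,2) by (auto simp: tol_le_def)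
  show "a \<in> F x y"
    using comp_dom[OF le tol] assms(3,4) \<phi>_in_I by blast
  then show "\<phi> x y a = \<phi> z y (\<phi> x z a)"
    by (rule comp[OF le tol])
qed

section \<open>The gluing relation is an equivalence\<close>

lemma sum_rel_iff:
  "((x, a), (y, b)) \<in> sum_rel \<gamma> L F \<phi> \<longleftrightarrow>
    a \<in> carrier (L x) \<and> b \<in> carrier (L y) \<and> \<gamma> x y \<and>
    a \<in> F x (sup x y) \<and> b \<in> F y (sup x y) \<and> \<phi> x (sup x y) a = \<phi> y (sup x y) b"
  by (simp add: sum_rel_def)

text \<open>
  For related pairs over \<open>x, y\<close> and \<open>y, z\<close>, put \<open>p = x \<squnion> y\<close>, \<open>q = y \<squnion> z\<close>. (MC7) applied to \<open>p, q\<close>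
  and (MC5) carry the middle element from \<open>y\<close> up to \<open>p \<squnion> q\<close>; the outer ones follow.
\<close>
lemma sum_rel_trans:
  assumes "((x, a), (y, b)) \<in> sum_rel \<gamma> L F \<phi>" "((y, b), (z, c)) \<in> sum_rel \<gamma> L F \<phi>"
  shows "((x, a), (z, c)) \<in> sum_rel \<gamma> L F \<phi>"
proof -
  define p q m r s where "p = sup x y" and "q = sup y z" and "m = inf p q" and "r = sup p q"
    and "s = sup x z"
  note defs = p_def q_def m_def r_def s_def
  have xy: "\<gamma> x y" "a \<in> F x p" "b \<in> F y p" "\<phi> x p a = \<phi> y p b" and aL: "a \<in> carrier (L x)"
    using assms(1) by (simp_all add: sum_rel_iff defs)
  have yz: "\<gamma> y z" "b \<in> F y q" "c \<in> F z q" "\<phi> y q b = \<phi> z q c" and cL: "c \<in> carrier (L z)"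
    using assms(2) by (simp_all add: sum_rel_iff defs)
  have le: "x \<le> p" "y \<le> p" "y \<le> q" "z \<le> q" "y \<le> m" "m \<le> p" "m \<le> q" "p \<le> r" "q \<le> r"
    "m \<le> r" "x \<le> s" "z \<le> s" "s \<le> r"
    unfolding defs by (auto intro: le_infI1 le_supI1 le_supI2)
  have xp: "\<gamma> x p" and yp: "\<gamma> y p"
    unfolding p_def using tol_le_sup[OF xy(1)] by auto
  have yq: "\<gamma> y q" and zq: "\<gamma> z q"
    unfolding q_def using tol_le_sup[OF yz(1)] by auto
  \<comment> \<open>Join \<open>\<gamma> p y\<close> with \<open>\<gamma> y q\<close>;
    \<open>y\<close> is absorbed on both sides.\<close>
  have qp: "\<gamma> p q"
    using tol_sup[OF tol_sym[OF yp] yq] le(2,3) by (simp add: sup_absorb1 sup_absorb2)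
  have pr: "\<gamma> p r" and qr: "\<gamma> q r"
    unfolding r_def using tol_le_sup[OF qp] by auto
  have ym: "\<gamma> y m"
    using tol_lower[OF le(5,6) yp] .
  have mp: "\<gamma> m p" and mq: "\<gamma> m q"
    using tol_inf[OF tol_refl tol_sym[OF qp], of p] tol_inf[OF qp tol_refl, of q]
    by (simp_all add: m_def)
  have mr: "\<gamma> m r"
    using tol_sup[OF mp mq] by (simp add: r_def)
  have "\<phi> y m b \<in> F m p \<inter> F m q"
    using F_restrict(2)[OF le(5,6) yp xy(3)] F_restrict(2)[OF le(5,7) yq yz(2)] by blast
  then have mb: "\<phi> y m b \<in> F m r"
    using square_dom[OF qp] unfolding m_def r_def by blast
  have bm: "b \<in> F y m"
    using F_restrict(1)[OF le(5,6) yp xy(3)] .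
  have yr: "\<gamma> y r" and br: "b \<in> F y r"
    using F_extend[of y m r b] ym mr le bm mb by (auto simp: tol_le_def)
  have yler: "y \<le> r"
    using le by (meson order_trans)
  have xr: "\<gamma> x r" "a \<in> F x r" "\<phi> x r a = \<phi> y r b"
    using F_extend[of x p r a] F_restrict[OF le(2,8) yr br] xp pr le xy by (auto simp: tol_le_def)
  have zr: "\<gamma> z r" "c \<in> F z r" "\<phi> z r c = \<phi> y r b"
    using F_extend[of z q r c] F_restrict[OF le(3,9) yr br] zq qr le yz by (auto simp: tol_le_def)
  have xler: "x \<le> r" and zler: "z \<le> r"
    using le by (meson order_trans)+
  \<comment> \<open>Meet \<open>\<gamma> x r\<close> with \<open>\<gamma> r z\<close>.\<close>
  have xz: "\<gamma> x z"
    using tol_inf[OF xr(1) tol_sym[OF zr(1)]] xler zler by (simp add: inf_absorb1 inf_absorb2)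
  \<comment> \<open>Both elements reach \<open>r\<close> through \<open>s\<close>, so injectivity of
    \<open>\<phi> s r\<close> pulls their equality at \<open>r\<close> back to
    \<open>s\<close>.\<close>
  have as: "a \<in> F x s" "\<phi> x s a \<in> F s r" "\<phi> x r a = \<phi> s r (\<phi> x s a)"
    using F_restrict[OF le(11,13) xr(1,2)] by auto
  have cs: "c \<in> F z s" "\<phi> z s c \<in> F s r" "\<phi> z r c = \<phi> s r (\<phi> z s c)"
    using F_restrict[OF le(12,13) zr(1,2)] by auto
  have sr: "tol_le \<gamma> s r"
    using tol_upper[OF le(11,13) xr(1)] le(13) by (simp add: tol_le_def)
  have "\<phi> s r (\<phi> x s a) = \<phi> s r (\<phi> z s c)"
    using as(3) cs(3) xr(3) zr(3) by metis
  then have "\<phi> x s a = \<phi> z s c"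
    by (rule \<phi>_inj[OF sr as(2) cs(2)])
  then show ?thesis
    using aL cL xz as(1) cs(1) by (simp add: sum_rel_iff s_def)
qed

lemma equiv_sum_rel: "equiv (SIGMA x:UNIV. carrier (L x)) (sum_rel \<gamma> L F \<phi>)"
proof (rule equivI)
  show "sum_rel \<gamma> L F \<phi> \<subseteq> (SIGMA x:UNIV. carrier (L x)) \<times> (SIGMA x:UNIV. carrier (L x))"
    by (auto simp: sum_rel_def)
  show "refl_on (SIGMA x:UNIV. carrier (L x)) (sum_rel \<gamma> L F \<phi>)"
    by (auto simp: refl_on_def sum_rel_def tol_refl id)
  show "sym (sum_rel \<gamma> L F \<phi>)"
    by (auto simp: sym_def sum_rel_iff tol_sym sup.commute)
  show "trans (sum_rel \<gamma> L F \<phi>)"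
    using sum_rel_trans unfolding trans_def by fast
qed

section \<open>Blocks inside the sum and their local orders\<close>

lemma proj_eq_iff:
  assumes "a \<in> carrier (L x)" "b \<in> carrier (L y)"
  shows "proj x a = proj y b \<longleftrightarrow> ((x, a), (y, b)) \<in> sum_rel \<gamma> L F \<phi>"
  unfolding sum_proj_def using eq_equiv_class_iff[OF equiv_sum_rel] assms by auto

text \<open>Here \<open>sup x y\<close> is \<open>y\<close> and \<open>\<phi> y y\<close> is the
  identity, so gluing reduces to the graph of \<open>\<phi> x y\<close>.\<close>

lemma proj_eq_iff_le:
  assumes "a \<in> carrier (L x)" "b \<in> carrier (L y)" "x \<le> y"
  shows "proj x a = proj y b \<longleftrightarrow> \<gamma> x y \<and> a \<in> F x y \<and> \<phi> x y a = b"
  using assms by (auto simp: proj_eq_iff sum_rel_iff sup_absorb2 id)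

lemma proj_inj: "inj_on (proj x) (carrier (L x))"
  by (rule inj_onI) (simp add: proj_eq_iff_le id)

lemma proj_\<phi>: "tol_le \<gamma> x y \<Longrightarrow> a \<in> F x y \<Longrightarrow> proj y (\<phi> x y a) = proj x a"
  using proj_eq_iff_le[of a x "\<phi> x y a" y] F_closed \<phi>_closed by (auto simp: tol_le_def)

lemma proj_in_block: "a \<in> carrier (L x) \<Longrightarrow> proj x a \<in> \<Lambda> x"
  by (simp add: sum_block_def)

lemma local_le_iff:
  "local_le v A B \<longleftrightarrow>
    (\<exists>a\<in>carrier (L v). \<exists>b\<in>carrier (L v). A = proj v a \<and> B = proj v b \<and> a \<sqsubseteq>\<^bsub>L v\<^esub> b)"
  unfolding sum_local_le_def sum_block_def
  by (fastforce simp: the_inv_into_f_f[OF proj_inj])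

lemma local_leE:
  assumes "local_le v A B"
  obtains a b where "a \<in> carrier (L v)" "b \<in> carrier (L v)" "A = proj v a" "B = proj v b"
    "a \<sqsubseteq>\<^bsub>L v\<^esub> b"
  using assms by (auto simp: local_le_iff)

lemma local_le_block: "local_le v A B \<Longrightarrow> A \<in> \<Lambda> v" "local_le v A B \<Longrightarrow> B \<in> \<Lambda> v"
  by (simp_all add: sum_local_le_def)

lemma local_le_proj_iff:
  "\<lbrakk>a \<in> carrier (L v); b \<in> carrier (L v)\<rbrakk>
    \<Longrightarrow> local_le v (proj v a) (proj v b) \<longleftrightarrow> a \<sqsubseteq>\<^bsub>L v\<^esub> b"
  by (simp add: sum_local_le_def proj_in_block the_inv_into_f_f[OF proj_inj])

lemma local_le_refl: "A \<in> \<Lambda> v \<Longrightarrow> local_le v A A"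
  by (auto simp: sum_block_def local_le_proj_iff block_refl)

lemma local_le_trans:
  assumes "local_le v A B" "local_le v B C"
  shows "local_le v A C"
proof -
  obtain a b where ab: "a \<in> carrier (L v)" "b \<in> carrier (L v)" "A = proj v a" "B = proj v b"
    "a \<sqsubseteq>\<^bsub>L v\<^esub> b"
    using assms(1) by (rule local_leE)
  obtain b' c where bc: "b' \<in> carrier (L v)" "c \<in> carrier (L v)" "B = proj v b'" "C = proj v c"
    "b' \<sqsubseteq>\<^bsub>L v\<^esub> c"
    using assms(2) by (rule local_leE)
  have "b' = b"
    using inj_onD[OF proj_inj _ bc(1) ab(2)] ab(4) bc(3) by simp
  then have "a \<sqsubseteq>\<^bsub>L v\<^esub> c"
    using block_trans ab(1,2,5) bc(2,5) by blast
  then show ?thesis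
    using local_le_proj_iff[OF ab(1) bc(2)] ab(3) bc(4) by simp
qed

section \<open>Transport of local steps between blocks\<close>

text \<open>The two representatives of \<open>A\<close> have a common image at
  \<open>sup x y\<close>, which represents \<open>A\<close> there.\<close>

lemma block_sup:
  assumes "A \<in> \<Lambda> x" "A \<in> \<Lambda> y"
  shows "A \<in> \<Lambda> (sup x y)"
proof -
  obtain a b where ab: "a \<in> carrier (L x)" "A = proj x a" "b \<in> carrier (L y)" "A = proj y b"
    using assms by (auto simp: sum_block_def)
  then have "((x, a), (y, b)) \<in> sum_rel \<gamma> L F \<phi>"
    using proj_eq_iff[of a x b y] by simp
  then have *: "a \<in> F x (sup x y)" "tol_le \<gamma> x (sup x y)"
    using tol_le_sup(1) by (auto simp: sum_rel_iff tol_le_def)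
  show ?thesis
    using proj_\<phi>[OF *(2,1)] proj_in_block[OF \<phi>_closed[OF *(2,1)]] ab(2) by simp
qed

text \<open>The map from \<open>x\<close> to \<open>y\<close> factors through \<open>z\<close>, so
  the representative at \<open>x\<close> has an image at \<open>z\<close>.\<close>

lemma block_between:
  assumes "A \<in> \<Lambda> x" "A \<in> \<Lambda> y" "x \<le> z" "z \<le> y"
  shows "A \<in> \<Lambda> z"
proof -
  obtain a b where ab: "a \<in> carrier (L x)" "A = proj x a" "b \<in> carrier (L y)" "A = proj y b"
    using assms by (auto simp: sum_block_def)
  then have *: "\<gamma> x y" "a \<in> F x y"
    using proj_eq_iff_le[of a x b y] assms(3,4) by auto
  then have **: "tol_le \<gamma> x z" "a \<in> F x z"
    using F_restrict(1)[OF assms(3,4) *] tol_lower[OF assms(3,4) *(1)] assms(3)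
    by (auto simp: tol_le_def)
  show ?thesis
    using proj_\<phi>[OF **] proj_in_block[OF \<phi>_closed[OF **]] ab(2) by simp
qed

text \<open>Only the lower end has to lie in \<open>\<Lambda> z\<close>: its representative is in
  the filter \<open>F v z\<close>, which then also contains that of \<open>B\<close>.\<close>

lemma local_le_up:
  assumes "local_le v A B" "A \<in> \<Lambda> z" "v \<le> z"
  shows "local_le z A B"
proof -
  obtain a b where ab: "a \<in> carrier (L v)" "b \<in> carrier (L v)" "A = proj v a" "B = proj v b"
    "a \<sqsubseteq>\<^bsub>L v\<^esub> b"
    using assms(1) by (rule local_leE)
  obtain a' where "a' \<in> carrier (L z)" "A = proj z a'"
    using assms(2) by (auto simp: sum_block_def)
  then have t: "tol_le \<gamma> v z" and a: "a \<in> F v z"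
    using proj_eq_iff_le[of a v a' z] ab assms(3) by (auto simp: tol_le_def)
  have b: "b \<in> F v z"
    using F_upward[OF t a ab(2,5)] .
  have "local_le z (proj z (\<phi> v z a)) (proj z (\<phi> v z b))"
    using local_le_proj_iff[of _ z] \<phi>_closed[OF t] \<phi>_le_iff[OF t a b] a b ab(5) by simp
  then show ?thesis
    using proj_\<phi>[OF t] a b ab(3,4) by simp
qed

text \<open>Dually, the representative of \<open>B\<close> is in the ideal \<open>I z v\<close>,
  hence so is that of \<open>A\<close>, which therefore has a preimage in
  \<open>L z\<close>.\<close>

lemma local_le_down:
  assumes "local_le v A B" "B \<in> \<Lambda> z" "z \<le> v"
  shows "local_le z A B"
proof -
  obtain a b where ab: "a \<in> carrier (L v)" "b \<in> carrier (L v)" "A = proj v a" "B = proj v b"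
    "a \<sqsubseteq>\<^bsub>L v\<^esub> b"
    using assms(1) by (rule local_leE)
  obtain b' where b': "b' \<in> carrier (L z)" "B = proj z b'"
    using assms(2) by (auto simp: sum_block_def)
  then have t: "tol_le \<gamma> z v" and bF: "b' \<in> F z v" "\<phi> z v b' = b"
    using proj_eq_iff_le[of b' z b v] ab assms(3) by (auto simp: tol_le_def)
  have "a \<in> I z v"
    using I_downward[OF t _ ab(1,5)] \<phi>_in_I[OF bF(1)] bF(2) by simp
  then obtain a' where a': "a' \<in> F z v" "\<phi> z v a' = a"
    by (auto simp: I_def)
  have "a' \<sqsubseteq>\<^bsub>L z\<^esub> b'"
    using \<phi>_le_iff[OF t a'(1) bF(1)] a'(2) bF(2) ab(5) by simp
  then have "local_le z (proj z a') (proj z b')"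
    using local_le_proj_iff F_closed[OF t a'(1)] b'(1) by simp
  then show ?thesis
    using proj_\<phi>[OF t a'(1)] a'(2) ab(3) b'(2) by simp
qed

section \<open>The sum order restricted to a block\<close>

lemma sum_le_imp_local_le:
  assumes "sum_le \<gamma> L F \<phi> A B" "A \<in> \<Lambda> w" "B \<in> \<Lambda> w"
  shows "local_le w A B"
proof -
  obtain n x c where mono: "\<And>i. Suc i < n \<Longrightarrow> x i \<le> x (Suc i)"
    and ends: "c 0 = A" "c n = B"
    and step: "\<And>i. i < n \<Longrightarrow> local_le (x i) (c i) (c (Suc i))"
    using assms(1) unfolding sum_le_def by blast
  show ?thesis
  proof (cases n)
    case 0
    then show ?thesis
      using ends assms(2) local_le_refl by simp
  next
    case (Suc k)
    define y where "y i = sup w (x i)" for i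
    \<comment> \<open>With the new index written as this join, \<open>block_sup\<close> applies to
      \<open>c (Suc i)\<close>, which ends one step and starts the next.\<close>
    have y_Suc: "sup (y i) (x (Suc i)) = y (Suc i)" if "i < k" for i
      using mono[of i] that Suc by (simp add: y_def sup_assoc sup_absorb2)
    have y_mono: "y i \<le> y (Suc i)" if "i < k" for i
      using y_Suc[OF that] by (metis sup_ge1)
    \<comment> \<open>Each lifted step places its upper end in \<open>\<Lambda> (y i)\<close>, which
      is what lifting the next step requires; \<open>A \<in> \<Lambda> w\<close> starts
      this.\<close>
    have y_step: "local_le (y i) (c i) (c (Suc i))" if "i \<le> k" for i
      using that
    proof (induction i)
      case 0
      have "c 0 \<in> \<Lambda> (y 0)"
        unfolding y_def using block_sup[OF _ local_le_block(1)[OF step[of 0]]] assms(2) ends Suc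
        by simp
      then show ?case
        using local_le_up[OF step[of 0]] Suc by (simp add: y_def)
    next
      case (Suc i)
      have "c (Suc i) \<in> \<Lambda> (sup (y i) (x (Suc i)))"
        using block_sup local_le_block(2)[OF Suc.IH] local_le_block(1)[OF step[of "Suc i"]]
          Suc.prems \<open>n = Suc k\<close> by simp
      then have "c (Suc i) \<in> \<Lambda> (y (Suc i))"
        using y_Suc Suc.prems by simp
      then show ?case
        using local_le_up[OF step[of "Suc i"]] Suc.prems \<open>n = Suc k\<close> by (simp add: y_def)
    qed
    have B_top: "B \<in> \<Lambda> (y k)"
      using local_le_block(2)[OF y_step[of k]] ends Suc by simp
    have y_le: "y i \<le> y k" if "i \<le> k" for i
      using that by (induction rule: inc_induct) (auto intro: order_trans y_mono)
    \<comment> \<open>\<open>y i\<close> lies between \<open>w\<close> and \<open>y k\<close>, and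
      \<open>B\<close> is in both of their blocks.\<close>
    have B_in: "B \<in> \<Lambda> (y i)" if "i \<le> k" for i
      using block_between[OF assms(3) B_top _ y_le[OF that]] by (simp add: y_def)
    \<comment> \<open>Induction from \<open>k\<close> down to \<open>0\<close>: the composite
      obtained so far is lowered to \<open>y i\<close>, where it composes with the
      \<open>i\<close>-th lifted step.\<close>
    have "local_le (y 0) (c 0) B"
    proof (rule inc_induct[of 0 k])
      show "local_le (y k) (c k) B"
        using y_step[of k] ends Suc by simp
    next
      fix i assume i: "i < k" "local_le (y (Suc i)) (c (Suc i)) B"
      have "local_le (y i) (c (Suc i)) B"
        using local_le_down[OF i(2) B_in y_mono] i(1) by simp
      then show "local_le (y i) (c i) B"
        using local_le_trans[OF y_step] i(1) by simp
    qed simp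
    then show ?thesis
      using local_le_down[OF _ assms(3)] ends by (simp add: y_def)
  qed
qed

section \<open>Minima of the skeleton and of the sum\<close>

text \<open>\<open>I x y\<close> is nonempty because \<open>F x y\<close> is, and it is downward
  closed.\<close>

lemma bottom_in_I:
  assumes "tol_le \<gamma> x y"
  shows "\<bottom>\<^bsub>L y\<^esub> \<in> I x y"
proof -
  obtain a where "a \<in> F x y"
    using filter[OF assms] by blast
  then have a: "\<phi> x y a \<in> I x y"
    by (rule \<phi>_in_I)
  show ?thesis
    by (rule I_downward[OF assms a block_bottom_closed block_bottom_lower[OF I_closed[OF assms a]]])
qed

text \<open>The bound by \<open>v\<close> keeps the indices ascending when \<open>v\<close> is
  appended. A chain of \<open>n\<close> steps has indices below \<open>n\<close> but points up to
  \<open>n\<close>, hence the updates at \<open>n\<close> and at \<open>Suc n\<close>.\<close>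

lemma sum_le_snoc:
  assumes "\<forall>i. Suc i < n \<longrightarrow> x i \<le> x (Suc i)" "\<forall>i<n. x i \<le> v"
    "\<forall>i<n. local_le (x i) (c i) (c (Suc i))" "local_le v (c n) B"
  defines "x' \<equiv> x(n := v)" and "c' \<equiv> c(Suc n := B)"
  shows "\<forall>i. Suc i < Suc n \<longrightarrow> x' i \<le> x' (Suc i)" "\<forall>i<Suc n. x' i \<le> v"
    "\<forall>i<Suc n. local_le (x' i) (c' i) (c' (Suc i))" "c' 0 = c 0" "c' (Suc n) = B"
  using assms(1-4) by (auto simp: x'_def c'_def less_Suc_eq)

text \<open>Induction on the size of \<open>{z..x}\<close>, descending to a lower cover of
  \<open>x\<close>. The bound of the indices by \<open>x\<close> strengthens \<open>sum_le\<close>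
  so that a step in block \<open>x\<close> can be appended.\<close>

lemma minimum_to_bottom:
  assumes "\<And>y. z \<le> y"
  shows "\<exists>n u c. (\<forall>i. Suc i < n \<longrightarrow> u i \<le> u (Suc i)) \<and> (\<forall>i<n. u i \<le> x) \<and>
    (\<forall>i<n. local_le (u i) (c i) (c (Suc i))) \<and> c 0 = proj z \<bottom>\<^bsub>L z\<^esub> \<and> c n = proj x \<bottom>\<^bsub>L x\<^esub>"
proof (induction "card {z..x}" arbitrary: x rule: less_induct)
  case less
  show ?case
  proof (cases "x = z")
    case True
    then show ?thesis
      \<comment> \<open>The chain without steps; its index function is arbitrary.\<close>
      by (intro exI[of _ 0] exI[of _ "\<lambda>_. z"] exI[of _ "\<lambda>_. proj z \<bottom>\<^bsub>L z\<^esub>"]) simp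
  next
    case False
    then have "z < x"
      using assms[of x] by simp
    then obtain w where w: "w \<lessdot> x"
      using lffc_lower_cover[OF lffc] by blast
    then have wx: "w < x" "tol_le \<gamma> w x"
      using cover_tol by (auto simp: covered_by_def tol_le_def)
    have "finite {z..x}"
      using lffc by (simp add: lffc_def)
    moreover have "{z..w} \<subset> {z..x}"
      using wx(1) assms by (auto simp: psubset_eq)
    ultimately have "card {z..w} < card {z..x}"
      by (rule psubset_card_mono)
    from less[OF this] obtain n u c where
      chain: "\<forall>i. Suc i < n \<longrightarrow> u i \<le> u (Suc i)" "\<forall>i<n. u i \<le> w"
        "\<forall>i<n. local_le (u i) (c i) (c (Suc i))"
      and ends: "c 0 = proj z \<bottom>\<^bsub>L z\<^esub>" "c n = proj w \<bottom>\<^bsub>L w\<^esub>"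
      by blast
    \<comment> \<open>The bottom of \<open>L x\<close> is the image of some \<open>b\<close> in
      \<open>L w\<close>, so the missing step to it can be made inside block
      \<open>w\<close>.\<close>
    obtain b where b: "b \<in> F w x" "\<phi> w x b = \<bottom>\<^bsub>L x\<^esub>"
      using bottom_in_I[OF wx(2)] by (auto simp: I_def)
    have "local_le w (proj w \<bottom>\<^bsub>L w\<^esub>) (proj w b)"
      using local_le_proj_iff F_closed[OF wx(2) b(1)] block_bottom_closed block_bottom_lower
      by simp
    then have "local_le w (c n) (proj x \<bottom>\<^bsub>L x\<^esub>)"
      using proj_\<phi>[OF wx(2) b(1)] b(2) ends(2) by simp
    note snoc = sum_le_snoc[OF chain this]
    have "\<forall>i<Suc n. (u(n := w)) i \<le> x"
      using snoc(2) wx(1) by (meson less_imp_le order_trans)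
    with snoc(1,3,5) snoc(4)[unfolded ends(1)] show ?thesis by blast
  qed
qed

lemma sum_least_of_minimum:
  assumes "\<And>y. z \<le> y"
  shows "least (sum_lattice \<gamma> L F \<phi>) (proj z \<bottom>\<^bsub>L z\<^esub>) (carrier (sum_lattice \<gamma> L F \<phi>))"
  unfolding least_def
proof (intro conjI ballI)
  show "proj z \<bottom>\<^bsub>L z\<^esub> \<in> carrier (sum_lattice \<gamma> L F \<phi>)"
    using block_bottom_closed by (auto simp: sum_lattice_def sum_proj_def intro: quotientI)
next
  fix A assume "A \<in> carrier (sum_lattice \<gamma> L F \<phi>)"
  then obtain x a where a: "a \<in> carrier (L x)" "A = proj x a"
    by (auto simp: sum_lattice_def sum_proj_def elim!: quotientE)
  obtain n u c where
    chain: "\<forall>i. Suc i < n \<longrightarrow> u i \<le> u (Suc i)" "\<forall>i<n. u i \<le> x"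
      "\<forall>i<n. local_le (u i) (c i) (c (Suc i))"
    and ends: "c 0 = proj z \<bottom>\<^bsub>L z\<^esub>" "c n = proj x \<bottom>\<^bsub>L x\<^esub>"
    using minimum_to_bottom[OF assms, of x] by (elim exE conjE) (rule that)
  \<comment> \<open>\<open>A\<close> shares block \<open>x\<close> with the end of the chain, so one
    more step reaches it.\<close>
  have "local_le x (c n) A"
    using local_le_proj_iff a block_bottom_closed block_bottom_lower ends(2) by simp
  note snoc = sum_le_snoc[OF chain this]
  have "sum_le \<gamma> L F \<phi> (proj z \<bottom>\<^bsub>L z\<^esub>) A"
    unfolding sum_le_def using snoc(1,3,5) snoc(4)[unfolded ends(1)] by blast
  then show "proj z \<bottom>\<^bsub>L z\<^esub> \<sqsubseteq>\<^bsub>sum_lattice \<gamma> L F \<phi>\<^esub> A"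
    by (simp add: sum_lattice_def)
qed simp

lemma minimum_of_sum_least:
  assumes "least (sum_lattice \<gamma> L F \<phi>) m (carrier (sum_lattice \<gamma> L F \<phi>))"
  shows "\<exists>z::'s. \<forall>y. z \<le> y"
proof -
  have m_le: "sum_le \<gamma> L F \<phi> m (proj x a)" if "a \<in> carrier (L x)" for x a
    using assms that unfolding least_def
    by (auto simp: sum_lattice_def sum_proj_def intro: quotientI)
  \<comment> \<open>The minimum \<open>m\<close> is below the image of the bottom in the sum; both
    lie in \<open>\<Lambda> x\<close>, so the comparison already holds in
    \<open>L x\<close>.\<close>
  have bottom: "a = \<bottom>\<^bsub>L x\<^esub>" if "a \<in> carrier (L x)" "m = proj x a" for x a
  proof -
    have "local_le x m (proj x \<bottom>\<^bsub>L x\<^esub>)"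
      using sum_le_imp_local_le m_le proj_in_block block_bottom_closed that by simp
    then have "a \<sqsubseteq>\<^bsub>L x\<^esub> \<bottom>\<^bsub>L x\<^esub>"
      using local_le_proj_iff that block_bottom_closed by simp
    then show ?thesis
      using block_antisym block_bottom_closed block_bottom_lower that(1) by blast
  qed
  obtain x a where a: "a \<in> carrier (L x)" "m = proj x a"
    using assms by (auto simp: least_def sum_lattice_def sum_proj_def elim!: quotientE)
  have minimal: False if less: "y < x" for y
  proof -
    obtain w where w: "w \<lessdot> x"
      using lffc_lower_cover[OF lffc less] by blast
    then have wx: "tol_le \<gamma> w x"
      using cover_tol by (auto simp: covered_by_def tol_le_def)
    obtain b where b: "b \<in> F w x" "\<phi> w x b = \<bottom>\<^bsub>L x\<^esub>"
      using bottom_in_I[OF wx] by (auto simp: I_def)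
    have bL: "b \<in> carrier (L w)"
      using F_closed[OF wx b(1)] .
    have "m = proj w b"
      using proj_\<phi>[OF wx b(1)] b(2) bottom[OF a] a(2) by simp
    then have "\<bottom>\<^bsub>L w\<^esub> \<in> F w x"
      using bottom[OF bL] b(1) by simp
    then have "carrier (L w) \<subseteq> F w x"
      using F_upward[OF wx] block_bottom_lower by blast
    then show False
      using cover_proper(1)[OF w] F_closed[OF wx] by blast
  qed
  \<comment> \<open>In a lattice a minimal element is least: \<open>inf x y\<close> is not strictly
    below \<open>x\<close>, so it equals \<open>x\<close>.\<close>
  have "x \<le> y" for y
    using minimal[of "inf x y"] by (metis inf_le1 inf_le2 order_le_less)
  then show ?thesis by blast
qed

end

theorem theorem4p70:
  fixes \<gamma> :: "'s::lattice \<Rightarrow> 's \<Rightarrow> bool"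
    and L :: "'s \<Rightarrow> 'b gorder"
    and F :: "'s \<Rightarrow> 's \<Rightarrow> 'b set"
    and \<phi> :: "'s \<Rightarrow> 's \<Rightarrow> 'b \<Rightarrow> 'b"
  assumes "modular_connected_system \<gamma> L F \<phi>"
  shows "(\<exists>m. least (sum_lattice \<gamma> L F \<phi>) m (carrier (sum_lattice \<gamma> L F \<phi>)))
    \<longleftrightarrow> (\<exists>m::'s. \<forall>x. m \<le> x)"
  using modular_connected_system.minimum_of_sum_least[OF assms]
    modular_connected_system.sum_least_of_minimum[OF assms] by blast

end
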